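(* Let $G$ be a group of order $k\ge2$, let $A=M_k(\mathbb{C})$ be equipped with the $G$-crossed product grading, and let $n\geq 1$. Then the $G$-graded $n$-codimension satisfies $c_n^G(A)=m_k(n)$, where $m_k(n)$ is the number of directed graphs with vertex set $G$ and with $n$ edges labeled $1,\dots,n$ that have an Eulerian path starting at the identity vertex $e$ (and ending at some vertex of $G$). In particular, $c_n^G(A)$ does not depend on the group $G$ (only on its order $k$ and on $n$).
   Context: Crossed product grading: let $G$ be a finite group of order $k$, and index the rows and columns of $k\times k$ matrices by the elements of $G$ (with respect to some ordering of $G$). Let $e_h$ ($h\in G$) be the diagonal matrix unit at position $(h,h)$, and let $D_k$ be the set of diagonal matrices in $M_k(\mathbb{C})$. For $g\in G$ let $P_g$ be the permutation matrix sending the standard basis vector indexed by $h$ to the one indexed by $gh$; thus $P_gP_h=P_{gh}$, and $P_g\left(\sum_h a_he_h\right)P_g^{-1}=\sum_h a_he_{gh}$. The $G$-crossed product grading is $M_k(\mathbb{C})=\bigoplus_{g\in G}D_kP_g$, with $g$-component $D_kP_g$. Graded identities: let $\mathbb{Q}\langle X^G\rangle$ be the free associative algebra over $\mathbb{Q}$ on the noncommuting variables $x_{i,g}$, $i\ge1$, $g\in G$. A polynomial in it is a $G$-graded identity for $A$ if it vanishes whenever each variable $x_{i,g}$ is replaced by an arbitrary element of $D_kP_g$. Let $\mathrm{Id}^G(A)$ be the ideal of all such identities. Codimension: $P_n^G$ is the $\mathbb{Q}$-span of all monomials $x_{i_1,g_1}x_{i_2,g_2}\cdots x_{i_n,g_n}$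 with $\{i_1,\dots,i_n\}=\{1,\dots,n\}$ and $g_1,\dots,g_n\in G$ arbitrary, and $c_n^G(A)=\dim_{\mathbb{Q}} P_n^G/(P_n^G\cap \mathrm{Id}^G(A))$. Graphs: loops and multiple edges in either direction are allowed. A graph is given by specifying for each label $l\in\{1,\dots,n\}$ the initial and terminal vertex in $G$ of the edge labeled $l$; two graphs are the same if and only if these data coincide. An Eulerian path from vertex $a$ to vertex $b$ is an enumeration $i_1,\dots,i_n$ of all the edges (each used exactly once) such that $i_1$ starts at $a$, $i_n$ ends at $b$, and for $1\le l\le n-1$ the initial vertex of $i_{l+1}$ is the terminal vertex of $i_l$. It need not visit all vertices, and $a=b$ is allowed. *)

theory Defs
  imports
    Complex_Main
    "HOL-Library.Poly_Mapping"
    "HOL-Library.FuncSet"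
    "HOL-Algebra.Coset"
    "Jordan_Normal_Form.Matrix"
begin

section \<open>Dimension of a quotient space\<close>

definition add_coset :: "'b::ab_group_add set \<Rightarrow> 'b \<Rightarrow> 'b set" where
  "add_coset W v = (\<lambda>w. v + w) ` W"

text \<open>The cosets of the members of \<open>B\<close> form a (finite) basis of \<open>V/W\<close>. For a subspace \<open>W\<close>
  the independence clause also makes the cosets of different members of \<open>B\<close> different, so that
  \<open>card B\<close> is the number of basis vectors.\<close>

definition quotient_basis ::
  "('a::field \<Rightarrow> 'b::ab_group_add \<Rightarrow> 'b) \<Rightarrow> 'b set \<Rightarrow> 'b set \<Rightarrow> 'b set \<Rightarrow> bool" where
  "quotient_basis scale V W B \<longleftrightarrow>
     finite B \<and> B \<subseteq> V \<and>
     (\<forall>c. add_coset W (\<Sum>b\<in>B. scale (c b) b) = add_coset W 0 \<longrightarrow> (\<forall>b\<in>B. c b = 0)) \<and>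
     (\<forall>v\<in>V. \<exists>c. add_coset W v = add_coset W (\<Sum>b\<in>B. scale (c b) b))"

definition quotient_dim ::
  "('a::field \<Rightarrow> 'b::ab_group_add \<Rightarrow> 'b) \<Rightarrow> 'b set \<Rightarrow> 'b set \<Rightarrow> nat" where
  "quotient_dim scale V W = (THE d. \<exists>B. quotient_basis scale V W B \<and> card B = d)"

context vector_space
begin

lemma add_coset_eq_iff:
  assumes "subspace W"
  shows "add_coset W u = add_coset W v \<longleftrightarrow> u - v \<in> W"
proof
  assume "add_coset W u = add_coset W v"
  moreover have "u \<in> add_coset W u"
    using subspace_0[OF assms] unfolding add_coset_def by force
  ultimately show "u - v \<in> W"
    unfolding add_coset_def by auto
next
  have sub: "add_coset W x \<subseteq> add_coset W y" if "x - y \<in> W" for x y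
  proof
    fix z assume "z \<in> add_coset W x"
    then obtain w where w: "w \<in> W" "z = x + w" unfolding add_coset_def by auto
    then have "z = y + ((x - y) + w)" by (simp add: algebra_simps)
    then show "z \<in> add_coset W y"
      using subspace_add[OF assms that w(1)] unfolding add_coset_def by blast
  qed
  assume "u - v \<in> W"
  moreover from this have "v - u \<in> W"
    using subspace_neg[OF assms, of "u - v"] by simp
  ultimately show "add_coset W u = add_coset W v"
    using sub by blast
qed

lemma quotient_basis_card_le:
  assumes W: "subspace W" and B: "quotient_basis scale V W B" and C: "quotient_basis scale V W C"
  shows "card B \<le> card C"
proof -
  have fin: "finite B" "finite C" and BV: "B \<subseteq> V"
    using B C by (auto simp: quotient_basis_def)
  have ind: "\<forall>b\<in>B. c b = 0" if "(\<Sum>b\<in>B. scale (c b) b) \<in> W" for c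
    using B that add_coset_eq_iff[OF W, of _ 0] by (auto simp: quotient_basis_def)
  have "\<exists>u. u \<in> span C \<and> b - u \<in> W" if b: "b \<in> B" for b
  proof -
    obtain c where "add_coset W b = add_coset W (\<Sum>x\<in>C. scale (c x) x)"
      using C b BV unfolding quotient_basis_def by blast
    then have "b - (\<Sum>x\<in>C. scale (c x) x) \<in> W" using add_coset_eq_iff[OF W] by blast
    moreover have "(\<Sum>x\<in>C. scale (c x) x) \<in> span C"
      by (intro span_sum span_scale span_base)
    ultimately show ?thesis by blast
  qed
  then obtain f where f: "f b \<in> span C" "b - f b \<in> W" if "b \<in> B" for b
    by metis
  have key: "\<forall>b\<in>B. c b = 0" if z: "(\<Sum>b\<in>B. scale (c b) (f b)) = 0" for c
  proof (rule ind)
    have "(\<Sum>b\<in>B. scale (c b) b) = (\<Sum>b\<in>B. scale (c b) (b - f b))"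
      using z by (simp add: scale_right_diff_distrib sum_subtractf)
    also have "\<dots> \<in> W" using f W by (intro subspace_sum subspace_scale) auto
    finally show "(\<Sum>b\<in>B. scale (c b) b) \<in> W" .
  qed
  have inj: "inj_on f B"
  proof (rule inj_onI, rule ccontr)
    fix a b assume ab: "a \<in> B" "b \<in> B" "f a = f b" "a \<noteq> b"
    define c where "c x = (if x = a then 1 else if x = b then - 1 else (0::'a))" for x
    have "(\<Sum>x\<in>B. scale (c x) (f x)) = (\<Sum>x\<in>{a, b}. scale (c x) (f x))"
      using fin ab by (intro sum.mono_neutral_right) (auto simp: c_def)
    also have "\<dots> = 0" using ab by (simp add: c_def)
    finally show False using key[of c] ab by (auto simp: c_def)
  qed
  have "independent (f ` B)"
  proof
    assume "dependent (f ` B)"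
    then obtain c where c: "\<exists>v\<in>f ` B. c v \<noteq> 0" "(\<Sum>v\<in>f ` B. scale (c v) v) = 0"
      using dependent_finite[of "f ` B"] fin by auto
    then have "(\<Sum>b\<in>B. scale (c (f b)) (f b)) = 0"
      using inj by (simp add: sum.reindex)
    then have "\<forall>b\<in>B. c (f b) = 0" using key[of "\<lambda>b. c (f b)"] by simp
    with c(1) show False by auto
  qed
  then have "card (f ` B) \<le> card C"
    using independent_span_bound[of C "f ` B"] fin f by auto
  then show ?thesis using inj by (simp add: card_image)
qed

lemma quotient_dim_eq_card:
  assumes "subspace W" "quotient_basis scale V W B"
  shows "quotient_dim scale V W = card B"
  unfolding quotient_dim_def
  using assms quotient_basis_card_le by (intro the_equality) (auto intro: antisym)

end


section \<open>The free associative algebra over the rationals\<close>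

datatype 'v word = Word (letters: "'v list")

instantiation word :: (type) monoid_add
begin

definition "0 = Word []"

definition "u + v = Word (letters u @ letters v)"

instance
  by standard (auto simp: zero_word_def plus_word_def)

end

text \<open>The convolution product of finitely supported functions on the free monoid is the product
  of the free algebra.\<close>

type_synonym 'v free_alg = "'v word \<Rightarrow>\<^sub>0 rat"

definition scaleQ :: "rat \<Rightarrow> 'v free_alg \<Rightarrow> 'v free_alg" where
  "scaleQ c p = Poly_Mapping.map ((*) c) p"

lemma lookup_scaleQ [simp]: "Poly_Mapping.lookup (scaleQ c p) w = c * Poly_Mapping.lookup p w"
  by (simp add: scaleQ_def Poly_Mapping.map.rep_eq when_def)

global_interpretation free_alg: vector_space scaleQ
  by unfold_locales (auto intro!: poly_mapping_eqI simp: lookup_add algebra_simps)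

definition var :: "'v \<Rightarrow> 'v free_alg" where
  "var x = Poly_Mapping.single (Word [x]) 1"

lemma prod_list_var: "prod_list (map var xs) = Poly_Mapping.single (Word xs) 1"
proof (induction xs)
  case Nil
  show ?case by (simp flip: zero_word_def)
next
  case (Cons x xs)
  then show ?case by (simp add: var_def mult_single plus_word_def)
qed

definition free_alg_on :: "'v set \<Rightarrow> 'v free_alg set" where
  "free_alg_on X = {p. \<forall>w \<in> Poly_Mapping.keys p. set (letters w) \<subseteq> X}"


section \<open>Graded identities and codimensions of graded matrix algebras\<close>

definition eval_word :: "nat \<Rightarrow> ('v \<Rightarrow> complex mat) \<Rightarrow> 'v word \<Rightarrow> complex mat" where
  "eval_word N \<rho> w = foldr (\<lambda>x M. \<rho> x * M) (letters w) (1\<^sub>m N)"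

definition eval_poly :: "nat \<Rightarrow> ('v \<Rightarrow> complex mat) \<Rightarrow> 'v free_alg \<Rightarrow> complex mat" where
  "eval_poly N \<rho> p =
     (\<Oplus>\<^bsub>ring_mat TYPE(complex) N ()\<^esub> w \<in> Poly_Mapping.keys p.
        of_rat (Poly_Mapping.lookup p w) \<cdot>\<^sub>m eval_word N \<rho> w)"

text \<open>The pair \<open>(i, g)\<close> stands for the variable \<open>x\<^sub>i\<^sub>,\<^sub>g\<close>.\<close>

definition graded_vars :: "('a, 'm) monoid_scheme \<Rightarrow> (nat \<times> 'a) set" where
  "graded_vars G = {1..} \<times> carrier G"

text \<open>Below, \<open>A g\<close> is the \<open>g\<close>-component of a grading of the algebra of complex
  \<open>N \<times> N\<close> matrices.\<close>

definition graded_ids ::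
  "('a, 'm) monoid_scheme \<Rightarrow> nat \<Rightarrow> ('a \<Rightarrow> complex mat set) \<Rightarrow> (nat \<times> 'a) free_alg set" where
  "graded_ids G N A =
     {p \<in> free_alg_on (graded_vars G).
        \<forall>\<rho>. (\<forall>(i, g) \<in> graded_vars G. \<rho> (i, g) \<in> A g) \<longrightarrow> eval_poly N \<rho> p = 0\<^sub>m N N}"

definition graded_multilinear ::
  "('a, 'm) monoid_scheme \<Rightarrow> nat \<Rightarrow> (nat \<times> 'a) free_alg set" where
  "graded_multilinear G n = free_alg.span
     {prod_list (map var xs) |xs.
        length xs = n \<and> fst ` set xs = {1..n} \<and> snd ` set xs \<subseteq> carrier G}"

definition graded_codim ::
  "('a, 'm) monoid_scheme \<Rightarrow> nat \<Rightarrow> ('a \<Rightarrow> complex mat set) \<Rightarrow> nat \<Rightarrow> nat" where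
  "graded_codim G N A n =
     quotient_dim scaleQ (graded_multilinear G n)
       (graded_multilinear G n \<inter> graded_ids G N A)"


section \<open>The crossed product grading\<close>

text \<open>Rows and columns are numbered from \<open>0\<close>; the enumeration \<open>f\<close> of the group says that
  number \<open>i\<close> belongs to the element \<open>f i\<close>.\<close>

definition perm_mat :: "('a, 'm) monoid_scheme \<Rightarrow> (nat \<Rightarrow> 'a) \<Rightarrow> 'a \<Rightarrow> complex mat" where
  "perm_mat G f g =
     mat (order G) (order G) (\<lambda>(i, j). if f i = g \<otimes>\<^bsub>G\<^esub> f j then 1 else 0)"

definition crossed_component ::
  "('a, 'm) monoid_scheme \<Rightarrow> (nat \<Rightarrow> 'a) \<Rightarrow> 'a \<Rightarrow> complex mat set" where
  "crossed_component G f g =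
     {D * perm_mat G f g |D. D \<in> carrier_mat (order G) (order G) \<and> diagonal_mat D}"


section \<open>Labelled directed graphs with an Eulerian path\<close>

text \<open>\<open>E l\<close> is the pair of initial and terminal vertex of the edge with label \<open>l\<close>. Extensional
  functions are used so that each graph is counted once.\<close>

definition labelled_digraphs :: "'a set \<Rightarrow> nat \<Rightarrow> (nat \<Rightarrow> 'a \<times> 'a) set" where
  "labelled_digraphs V n = {1..n} \<rightarrow>\<^sub>E V \<times> V"

definition eulerian_path :: "nat \<Rightarrow> (nat \<Rightarrow> 'a \<times> 'a) \<Rightarrow> 'a \<Rightarrow> 'a \<Rightarrow> nat list \<Rightarrow> bool" where
  "eulerian_path n E a b p \<longleftrightarrow>
     distinct p \<and> set p = {1..n} \<and> fst (E (hd p)) = a \<and> snd (E (last p)) = b \<and>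
     (\<forall>l. Suc l < length p \<longrightarrow> fst (E (p ! Suc l)) = snd (E (p ! l)))"

definition eulerian_count :: "'a set \<Rightarrow> 'a \<Rightarrow> nat \<Rightarrow> nat" where
  "eulerian_count V a n =
     card {E \<in> labelled_digraphs V n. \<exists>b\<in>V. \<exists>p. eulerian_path n E a b p}"

end

theory Submission
  imports Defs
begin

text \<open>Substitute \<open>D\<^sub>i P\<^sub>g\<close> for \<open>x\<^sub>i\<^sub>,\<^sub>g\<close>. A row of \<open>D\<^sub>i P\<^sub>g\<close> has at most one nonzero
  entry: row \<open>v\<close> has it in column \<open>g\<^sup>-\<^sup>1 v\<close>. Hence row \<open>v\<close> of the value of a word
  \<open>x\<^sub>i\<^sub>,\<^sub>g x\<^sub>j\<^sub>,\<^sub>h \<dots>\<close> is governed by one walk \<open>v, g\<^sup>-\<^sup>1 v, h\<^sup>-\<^sup>1 g\<^sup>-\<^sup>1 v, \<dots>\<close>: its only entry that can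
  be nonzero stands in the column where the walk ends, and is the product of one entry of a
  substituted matrix for each step of the walk (\<open>eval_word_entry\<close>). The step \<open>s \<rightarrow> t\<close> labelled
  \<open>i\<close> uses the variable \<open>x\<^sub>i\<^sub>,\<^sub>g\<close> with \<open>g = s t\<^sup>-\<^sup>1\<close>, so the product depends on the labelled edges
  but not on their order. For a multilinear word the walk from \<open>e\<close> is an Eulerian path of a
  graph with edges labelled \<open>1, \<dots>, n\<close>, and every graph with an Eulerian path from \<open>e\<close> arises so
  (\<open>eulerian_iff_traced_graph\<close>).

  Two multilinear words with the same graph differ by an identity (\<open>eval_word_cong_graph\<close>). The
  graph fixes the end of the walk by counting arrivals and departures at each vertex, and the
  walk from any other vertex is a right translate of the walk from \<open>e\<close>, so that the graph at \<open>e\<close>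
  controls all rows. Conversely, for a given graph, substituting for each variable the sum of
  those of its matrix units that occur as edges gives \<open>1\<close> on the words with that graph and \<open>0\<close> on
  all others, at a suitable position (\<open>separating_subst\<close>). So the multilinear polynomials
  modulo identities have a basis indexed by these graphs; the linear algebra is
  \<open>quotient_dim_span_classes\<close>.

  The number of the graphs involves only the vertex set and its base vertex, whence it depends
  only on the order of the group (\<open>eulerian_count_eq\<close>).\<close>

section \<open>Quotients by a relation between spanning vectors\<close>

context vector_space
begin

text \<open>The criterion behind the codimension formula: one spanning vector from each class of \<open>\<kappa>\<close> gives
  a basis of the quotient. Hypothesis \<open>congruent\<close> makes these representatives span. Hypothesis
  \<open>separated\<close> makes them independent, because then the sum over a class has a single term; it also
  keeps different representatives from being the same vector.\<close>

lemma quotient_dim_span_classes: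
  fixes m :: "'x \<Rightarrow> 'b" and \<kappa> :: "'x \<Rightarrow> 'k"
  assumes X: "finite X" and N: "subspace N"
    and congruent: "\<And>x y. x \<in> X \<Longrightarrow> y \<in> X \<Longrightarrow> \<kappa> x = \<kappa> y \<Longrightarrow> m x - m y \<in> N"
    and separated: "\<And>c x. (\<Sum>y\<in>X. scale (c y) (m y)) \<in> N \<Longrightarrow> x \<in> X \<Longrightarrow>
      (\<Sum>y | y \<in> X \<and> \<kappa> y = \<kappa> x. c y) = 0"
  shows "quotient_dim scale (span (m ` X)) N = card (\<kappa> ` X)"
proof -
  define rep where "rep = inv_into X \<kappa>"
  define R where "R = rep ` \<kappa> ` X"
  have rep: "rep (\<kappa> x) \<in> X" "\<kappa> (rep (\<kappa> x)) = \<kappa> x" if "x \<in> X" for x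
    using that by (auto simp: rep_def inv_into_into f_inv_into_f)
  have RX: "R \<subseteq> X" using rep by (auto simp: R_def)
  have finR: "finite R" using X by (simp add: R_def)
  have classR: "{y \<in> R. \<kappa> y = \<kappa> x} = {x}" if "x \<in> R" for x
    using that rep by (auto simp: R_def)
  have cardR: "card R = card (\<kappa> ` X)"
    unfolding R_def rep_def by (intro card_image inj_on_inv_into) auto
  have indep: "c x = 0" if c: "(\<Sum>y\<in>R. scale (c y) (m y)) \<in> N" and x: "x \<in> R" for c x
  proof -
    define d where "d y = (if y \<in> R then c y else 0)" for y
    have "(\<Sum>y\<in>X. scale (d y) (m y)) = (\<Sum>y\<in>R. scale (c y) (m y))"
      using X RX by (intro sum.mono_neutral_cong_right) (auto simp: d_def)
    then have "(\<Sum>y | y \<in> X \<and> \<kappa> y = \<kappa> x. d y) = 0"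
      using c x RX by (intro separated) auto
    also have "(\<Sum>y | y \<in> X \<and> \<kappa> y = \<kappa> x. d y) = (\<Sum>y\<in>{y \<in> R. \<kappa> y = \<kappa> x}. c y)"
      using X RX by (intro sum.mono_neutral_cong_right) (auto simp: d_def)
    finally show ?thesis using classR[OF x] by simp
  qed
  have inj: "inj_on m R"
  proof (rule inj_onI, rule ccontr)
    fix a b assume ab: "a \<in> R" "b \<in> R" "m a = m b" "a \<noteq> b"
    \<comment> \<open>Two representatives with the same vector would give the relation \<open>m a - m b = 0\<close>.\<close>
    define c where "c x = (if x = a then 1 else if x = b then - 1 else (0::'a))" for x
    have "(\<Sum>x\<in>R. scale (c x) (m x)) = (\<Sum>x\<in>{a, b}. scale (c x) (m x))"
      using finR ab by (intro sum.mono_neutral_right) (auto simp: c_def)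
    also have "\<dots> = 0" using ab by (simp add: c_def)
    finally show False using indep[of c a] ab subspace_0[OF N] by (auto simp: c_def)
  qed
  have "\<exists>c. v - (\<Sum>b\<in>m ` R. scale (c b) b) \<in> N" if "v \<in> span (m ` X)" for v
    using that
  proof (induction rule: span_induct_alt)
    case base
    show ?case using subspace_0[OF N] by (intro exI[of _ "\<lambda>_. 0"]) simp
  next
    case (step a y v)
    then obtain x c where x: "x \<in> X" "y = m x" and c: "v - (\<Sum>b\<in>m ` R. scale (c b) b) \<in> N"
      by auto
    define r where "r = m (rep (\<kappa> x))"
    have r: "r \<in> m ` R" using x by (auto simp: r_def R_def)
    define d where "d b = (if b = r then a else 0) + c b" for b
    have "(\<Sum>b\<in>m ` R. scale (d b) b) =
        (\<Sum>b\<in>m ` R. if b = r then scale a r else 0) + (\<Sum>b\<in>m ` R. scale (c b) b)"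
      unfolding sum.distrib[symmetric]
      by (intro sum.cong) (auto simp: d_def scale_left_distrib)
    also have "(\<Sum>b\<in>m ` R. if b = r then scale a r else 0) = scale a r"
      using r finR by simp
    finally have "scale a y + v - (\<Sum>b\<in>m ` R. scale (d b) b) =
        scale a (m x - r) + (v - (\<Sum>b\<in>m ` R. scale (c b) b))"
      using x by (simp add: scale_right_diff_distrib)
    also have "\<dots> \<in> N"
      using congruent[of x "rep (\<kappa> x)"] rep[OF x(1)] x c
      by (intro subspace_add[OF N] subspace_scale[OF N]) (auto simp: r_def)
    finally show ?case by blast
  qed
  moreover have "c b = 0" if "(\<Sum>b\<in>m ` R. scale (c b) b) \<in> N" "b \<in> m ` R" for c b
    using that indep[of "c \<circ> m"] by (auto simp: sum.reindex[OF inj])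
  moreover have "m ` R \<subseteq> span (m ` X)" using RX by (auto intro: span_base)
  ultimately have "quotient_basis scale (span (m ` X)) N (m ` R)"
    using finR by (simp add: quotient_basis_def add_coset_eq_iff[OF N])
  then show ?thesis
    using quotient_dim_eq_card[OF N] by (simp add: card_image[OF inj] cardR)
qed

end


section \<open>The walk traced by a word\<close>

lemma labelled_digraphs_edge:
  "E \<in> labelled_digraphs V n \<Longrightarrow> l \<in> {1..n} \<Longrightarrow> E l \<in> V \<times> V"
  unfolding labelled_digraphs_def by (rule PiE_mem)

definition multilinear_words :: "('a, 'm) monoid_scheme \<Rightarrow> nat \<Rightarrow> (nat \<times> 'a) list set" where
  "multilinear_words G n =
     {xs. length xs = n \<and> fst ` set xs = {1..n} \<and> snd ` set xs \<subseteq> carrier G}"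

lemma multilinear_words_mset:
  assumes "xs \<in> multilinear_words G n"
  shows "distinct (map fst xs)" and "mset (map fst xs) = mset_set {1..n}"
proof -
  show "distinct (map fst xs)"
    using assms by (intro card_distinct) (auto simp: multilinear_words_def)
  from mset_set_set[OF this] assms show "mset (map fst xs) = mset_set {1..n}"
    by (simp add: multilinear_words_def)
qed

lemma multilinear_words_graded_vars:
  assumes "xs \<in> multilinear_words G n"
  shows "set xs \<subseteq> graded_vars G"
proof
  fix x assume "x \<in> set xs"
  then have "fst x \<in> {1..n}" "snd x \<in> carrier G"
    using assms by (auto simp: multilinear_words_def)
  then show "x \<in> graded_vars G" by (cases x) (auto simp: graded_vars_def)
qed

lemma finite_multilinear_words:
  assumes "finite (carrier G)"
  shows "finite (multilinear_words G n)"
proof (rule finite_subset)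
  show "multilinear_words G n \<subseteq> {xs. set xs \<subseteq> {1..n} \<times> carrier G \<and> length xs = n}"
    by (force simp: multilinear_words_def)
  show "finite {xs. set xs \<subseteq> {1..n} \<times> carrier G \<and> length xs = n}"
    using assms by (intro finite_lists_length_eq) auto
qed

context group
begin

text \<open>The walk lists its steps as triples of label, initial vertex and terminal vertex. A step of
  degree \<open>g\<close> goes from \<open>v\<close> to \<open>g\<^sup>-\<^sup>1 v\<close>, because multiplying matrices from left to right passes
  from a row index of \<open>D P\<^sub>g\<close> to the column index of the nonzero entry in that row.\<close>

fun walk :: "'a \<Rightarrow> ('l \<times> 'a) list \<Rightarrow> ('l \<times> 'a \<times> 'a) list" where
  "walk v [] = []"
| "walk v ((i, g) # xs) = (i, v, inv g \<otimes> v) # walk (inv g \<otimes> v) xs"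

fun walk_end :: "'a \<Rightarrow> ('l \<times> 'a) list \<Rightarrow> 'a" where
  "walk_end v [] = v"
| "walk_end v ((i, g) # xs) = walk_end (inv g \<otimes> v) xs"

lemma map_fst_walk [simp]: "map fst (walk v xs) = map fst xs"
  by (induction v xs rule: walk.induct) auto

lemma walk_end_closed:
  assumes "v \<in> carrier G" "snd ` set xs \<subseteq> carrier G"
  shows "walk_end v xs \<in> carrier G"
  using assms by (induction v xs rule: walk.induct) auto

lemma walk_in_carrier:
  assumes "v \<in> carrier G" "snd ` set xs \<subseteq> carrier G"
  shows "snd ` set (walk v xs) \<subseteq> carrier G \<times> carrier G"
  using assms by (induction v xs rule: walk.induct) auto

text \<open>Steps multiply the vertex on the left, so they commute with right translation. This is why the
  walk from one vertex carries the information about the walks from all vertices.\<close>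

lemma walk_translate:
  assumes "v \<in> carrier G" "h \<in> carrier G" "snd ` set xs \<subseteq> carrier G"
  shows "walk (v \<otimes> h) xs = map (\<lambda>(i, s, t). (i, s \<otimes> h, t \<otimes> h)) (walk v xs)"
  using assms by (induction v xs rule: walk.induct) (auto simp: m_assoc)

text \<open>Each departure, except the first, is from the vertex of the preceding arrival.\<close>

lemma walk_balance:
  "add_mset (walk_end v xs) (image_mset (fst \<circ> snd) (mset (walk v xs))) =
   add_mset v (image_mset (snd \<circ> snd) (mset (walk v xs)))"
  by (induction v xs rule: walk.induct) (auto simp: add_mset_commute)

text \<open>The same steps in another order have the same multisets of departures and of arrivals, so that
  the balance determines the one vertex left over.\<close>

lemma walk_end_determined:
  assumes "mset (walk v xs) = mset (walk v ys)"
  shows "walk_end v xs = walk_end v ys"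
proof -
  let ?S = "image_mset (fst \<circ> snd) (mset (walk v ys))"
  have "add_mset (walk_end v xs) ?S = add_mset (walk_end v ys) ?S"
    using walk_balance[of v xs] walk_balance[of v ys] assms by simp
  then show ?thesis using add_mset_add_mset_same_iff by simp
qed

definition traced_graph :: "nat \<Rightarrow> (nat \<times> 'a) list \<Rightarrow> nat \<Rightarrow> 'a \<times> 'a" where
  "traced_graph n xs = (\<lambda>l\<in>{1..n}. the (map_of (walk \<one> xs) l))"

lemma walk_eq_traced_graph:
  assumes "xs \<in> multilinear_words G n"
  shows "walk \<one> xs = map (\<lambda>l. (l, traced_graph n xs l)) (map fst xs)"
proof -
  have "x = (fst x, traced_graph n xs (fst x))" if x: "x \<in> set (walk \<one> xs)" for x
  proof -
    have "fst x \<in> fst ` set xs"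
      using x by (metis image_eqI list.set_map map_fst_walk)
    moreover have "map_of (walk \<one> xs) (fst x) = Some (snd x)"
      using x multilinear_words_mset(1)[OF assms] by (intro map_of_is_SomeI) auto
    ultimately show ?thesis
      using assms by (auto simp: traced_graph_def multilinear_words_def)
  qed
  then have "map (\<lambda>x. (fst x, traced_graph n xs (fst x))) (walk \<one> xs) = walk \<one> xs"
    by (intro map_idI) simp
  moreover have "map (\<lambda>l. (l, traced_graph n xs l)) (map fst (walk \<one> xs)) =
      map (\<lambda>x. (fst x, traced_graph n xs (fst x))) (walk \<one> xs)"
    by (simp del: map_fst_walk add: comp_def)
  ultimately show ?thesis by (metis map_fst_walk)
qed

lemma mset_walk_eq_traced_graph:
  assumes "xs \<in> multilinear_words G n"
  shows "mset (walk \<one> xs) = image_mset (\<lambda>l. (l, traced_graph n xs l)) (mset_set {1..n})"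
  using walk_eq_traced_graph[OF assms] multilinear_words_mset(2)[OF assms] by (metis mset_map)

lemma traced_graph_in_carrier:
  assumes "xs \<in> multilinear_words G n"
  shows "traced_graph n xs \<in> labelled_digraphs (carrier G) n"
proof -
  have "traced_graph n xs l \<in> carrier G \<times> carrier G" if "l \<in> {1..n}" for l
  proof -
    have "l \<in> set (map fst xs)" using that assms by (auto simp: multilinear_words_def)
    then have "(l, traced_graph n xs l) \<in> set (walk \<one> xs)"
      unfolding walk_eq_traced_graph[OF assms] by force
    then show ?thesis
      using walk_in_carrier[of \<one> xs] assms by (force simp: multilinear_words_def)
  qed
  then show ?thesis by (auto simp: labelled_digraphs_def PiE_def traced_graph_def)
qed

end


section \<open>Walks are Eulerian paths\<close>

text \<open>The recursive form of the linking condition of an Eulerian path, which suits induction along the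
  walk. The initial vertex is an argument, so that the empty path needs no default.\<close>

fun chain_from :: "(nat \<Rightarrow> 'a \<times> 'a) \<Rightarrow> 'a \<Rightarrow> nat list \<Rightarrow> bool" where
  "chain_from E v [] \<longleftrightarrow> True"
| "chain_from E v (l # p) \<longleftrightarrow> fst (E l) = v \<and> chain_from E (snd (E l)) p"

lemma chain_from_iff_nth:
  "p \<noteq> [] \<Longrightarrow> chain_from E v p \<longleftrightarrow> fst (E (hd p)) = v \<and>
    (\<forall>l. Suc l < length p \<longrightarrow> fst (E (p ! Suc l)) = snd (E (p ! l)))"
proof (induction p arbitrary: v)
  case Nil
  then show ?case by simp
next
  case (Cons l p)
  show ?case
  proof (cases "p = []")
    case False
    have "(\<forall>j. Suc j < length (l # p) \<longrightarrow> fst (E ((l # p) ! Suc j)) = snd (E ((l # p) ! j))) \<longleftrightarrow>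
        fst (E (hd p)) = snd (E l) \<and>
        (\<forall>j. Suc j < length p \<longrightarrow> fst (E (p ! Suc j)) = snd (E (p ! j)))" (is "?L \<longleftrightarrow> ?R")
    proof
      assume L: ?L
      show ?R using L[rule_format, of 0] L[rule_format, of "Suc _"] False
        by (auto simp: hd_conv_nth)
    next
      assume ?R
      then show ?L using False by (auto simp: hd_conv_nth nth_Cons split: nat.split)
    qed
    then show ?thesis using Cons.IH[OF False] by auto
  qed simp
qed

context group
begin

lemma chain_from_walk:
  assumes "\<forall>x\<in>set (walk v xs). E (fst x) = snd x"
  shows "chain_from E v (map fst xs)"
  using assms by (induction v xs rule: walk.induct) auto

text \<open>The degree of an edge from \<open>s\<close> to \<open>t\<close> has to be \<open>s t\<^sup>-\<^sup>1\<close>; with these degrees, any enumeration of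
  linked edges is the walk of a word.\<close>

lemma walk_of_chain:
  assumes "chain_from E v p" "E ` set p \<subseteq> carrier G \<times> carrier G"
  shows "walk v (map (\<lambda>l. (l, fst (E l) \<otimes> inv (snd (E l)))) p) = map (\<lambda>l. (l, E l)) p"
  using assms
proof (induction p arbitrary: v)
  case (Cons l p)
  then have "fst (E l) \<in> carrier G" "snd (E l) \<in> carrier G" by auto
  then have "inv (fst (E l) \<otimes> inv (snd (E l))) \<otimes> fst (E l) = snd (E l)"
    by (simp add: inv_mult_group m_assoc)
  with Cons show ?case by auto
qed simp

text \<open>For \<open>n = 0\<close> the ends of a path are given by \<open>hd\<close> and \<open>last\<close> of the empty list, so the claim is
  made for \<open>n \<ge> 1\<close>.\<close>

lemma eulerian_iff_traced_graph:
  assumes "n \<ge> 1"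
  shows "{E \<in> labelled_digraphs (carrier G) n. \<exists>b\<in>carrier G. \<exists>p. eulerian_path n E \<one> b p} =
    traced_graph n ` multilinear_words G n" (is "?L = ?R")
proof (intro equalityI subsetI)
  fix E assume "E \<in> ?L"
  then obtain b p where E: "E \<in> labelled_digraphs (carrier G) n"
    and p: "eulerian_path n E \<one> b p" by auto
  have sp: "distinct p" "set p = {1..n}" and ne: "p \<noteq> []"
    using p assms by (auto simp: eulerian_path_def)
  have len: "length p = n" using distinct_card[OF sp(1)] sp(2) by simp
  note EV = labelled_digraphs_edge[OF E]
  have ch: "chain_from E \<one> p"
    using p ne by (simp add: eulerian_path_def chain_from_iff_nth)
  define xs where "xs = map (\<lambda>l. (l, fst (E l) \<otimes> inv (snd (E l)))) p"
  have xs: "xs \<in> multilinear_words G n"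
    using sp len EV by (force simp: multilinear_words_def xs_def image_image mem_Times_iff)
  have w: "walk \<one> xs = map (\<lambda>l. (l, E l)) p"
    unfolding xs_def using ch sp EV by (intro walk_of_chain image_subsetI) auto
  have "traced_graph n xs l = E l" for l
  proof (cases "l \<in> {1..n}")
    case True
    then have "map_of (walk \<one> xs) l = Some (E l)"
      using sp by (auto simp: w map_of_map_restrict)
    then show ?thesis using True by (simp add: traced_graph_def)
  next
    case False
    then show ?thesis using E by (auto simp: traced_graph_def labelled_digraphs_def PiE_def extensional_def)
  qed
  then have "E = traced_graph n xs" by auto
  with xs show "E \<in> ?R" by blast
next
  fix E assume "E \<in> ?R"
  then obtain xs where xs: "xs \<in> multilinear_words G n" and E: "E = traced_graph n xs" by auto
  define p where "p = map fst xs"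
  have sp: "distinct p" "set p = {1..n}" and ne: "p \<noteq> []"
    using multilinear_words_mset(1)[OF xs] xs assms by (auto simp: p_def multilinear_words_def)
  have EV: "E \<in> labelled_digraphs (carrier G) n" using traced_graph_in_carrier[OF xs] E by simp
  have "last p \<in> {1..n}" using last_in_set[OF ne] sp by simp
  then have b: "snd (E (last p)) \<in> carrier G"
    using labelled_digraphs_edge[OF EV] by (simp add: mem_Times_iff)
  have "chain_from E \<one> p"
    unfolding p_def
    by (rule chain_from_walk) (auto simp: walk_eq_traced_graph[OF xs] E)
  then have "eulerian_path n E \<one> (snd (E (last p))) p"
    using sp ne by (simp add: eulerian_path_def chain_from_iff_nth)
  with EV b show "E \<in> ?L" by blast
qed

end


section \<open>Evaluating words by homogeneous matrices\<close>

locale enumerated_group = group +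
  fixes f :: "nat \<Rightarrow> 'a"
  assumes enum: "bij_betw f {..<order G} (carrier G)"
begin

definition idx :: "'a \<Rightarrow> nat" where
  "idx = the_inv_into {..<order G} f"

lemma finite_carrier: "finite (carrier G)"
  using bij_betw_finite[OF enum] by simp

lemma f_closed [simp]: "r < order G \<Longrightarrow> f r \<in> carrier G"
  using enum by (auto simp: bij_betw_def)

lemma f_eq_iff: "r < order G \<Longrightarrow> c < order G \<Longrightarrow> f r = f c \<longleftrightarrow> r = c"
  using enum by (auto simp: bij_betw_def inj_on_def)

lemma idx_less: "v \<in> carrier G \<Longrightarrow> idx v < order G"
  using bij_betw_the_inv_into[OF enum] by (auto simp: bij_betw_def idx_def)

lemma f_idx: "v \<in> carrier G \<Longrightarrow> f (idx v) = v"
  using enum by (auto simp: bij_betw_def idx_def f_the_inv_into_f)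

lemma idx_f: "r < order G \<Longrightarrow> idx (f r) = r"
  using enum by (auto simp: bij_betw_def idx_def the_inv_into_f_f)

lemma scalar_prod_single:
  fixes u v :: "complex vec"
  assumes "j < dim_vec v" "\<And>i. i < dim_vec v \<Longrightarrow> i \<noteq> j \<Longrightarrow> u $ i * v $ i = 0"
  shows "u \<bullet> v = u $ j * v $ j"
proof -
  have "u \<bullet> v = (\<Sum>i\<in>{j}. u $ i * v $ i)"
    unfolding scalar_prod_def using assms by (intro sum.mono_neutral_right) auto
  then show ?thesis by simp
qed

text \<open>The component of degree \<open>g\<close> consists of the matrices supported where \<open>P\<^sub>g\<close> is: there is one such
  position in each row, and the diagonal factor fills it with an arbitrary entry.\<close>

lemma crossed_component_iff:
  assumes g: "g \<in> carrier G"
  shows "M \<in> crossed_component G f g \<longleftrightarrow> M \<in> carrier_mat (order G) (order G) \<and>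
    (\<forall>r < order G. \<forall>c < order G. f r \<noteq> g \<otimes> f c \<longrightarrow> M $$ (r, c) = 0)"
    (is "?L \<longleftrightarrow> ?R")
proof -
  have entry: "(D * perm_mat G f g) $$ (r, c) = (if f r = g \<otimes> f c then D $$ (r, r) else 0)"
    if D: "D \<in> carrier_mat (order G) (order G)" "diagonal_mat D"
      and rc: "r < order G" "c < order G" for D r c
  proof -
    have "(D * perm_mat G f g) $$ (r, c) = row D r \<bullet> col (perm_mat G f g) c"
      using D rc by (simp add: perm_mat_def)
    also have "\<dots> = row D r $ r * col (perm_mat G f g) c $ r"
      using D rc by (intro scalar_prod_single) (auto simp: perm_mat_def diagonal_mat_def)
    finally show ?thesis using D rc by (simp add: perm_mat_def)
  qed
  show ?thesis
  proof
    assume ?L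
    then show ?R using entry by (auto simp: crossed_component_def perm_mat_def)
  next
    assume R: ?R
    define D where "D = mat (order G) (order G)
      (\<lambda>(r, c). if r = c then M $$ (r, idx (inv g \<otimes> f r)) else 0)"
    have D: "D \<in> carrier_mat (order G) (order G)" "diagonal_mat D"
      by (auto simp: D_def diagonal_mat_def)
    have "M = D * perm_mat G f g"
    proof (rule eq_matI)
      fix r c assume "r < dim_row (D * perm_mat G f g)" "c < dim_col (D * perm_mat G f g)"
      then have rc: "r < order G" "c < order G" by (auto simp: D_def perm_mat_def)
      have "idx (inv g \<otimes> f r) = c" if "f r = g \<otimes> f c"
        using that g rc by (simp add: m_assoc[symmetric] idx_f)
      then show "M $$ (r, c) = (D * perm_mat G f g) $$ (r, c)"
        using R rc by (auto simp: entry[OF D rc]) (simp add: D_def)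
    qed (use R in \<open>auto simp: D_def perm_mat_def\<close>)
    then show ?L using D by (auto simp: crossed_component_def)
  qed
qed

definition homogeneous_subst :: "(nat \<times> 'a \<Rightarrow> complex mat) \<Rightarrow> bool" where
  "homogeneous_subst \<rho> \<longleftrightarrow> (\<forall>(i, g) \<in> graded_vars G. \<rho> (i, g) \<in> crossed_component G f g)"

lemma eval_word_carrier:
  assumes "homogeneous_subst \<rho>" "set xs \<subseteq> graded_vars G"
  shows "eval_word (order G) \<rho> (Word xs) \<in> carrier_mat (order G) (order G)"
  using assms(2)
proof (induction xs)
  case (Cons x xs)
  obtain i g where x: "x = (i, g)" by force
  with Cons.prems have "g \<in> carrier G" "(i, g) \<in> graded_vars G" by (auto simp: graded_vars_def)
  then have "\<rho> x \<in> carrier_mat (order G) (order G)"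
    using assms(1) crossed_component_iff by (auto simp: homogeneous_subst_def x)
  with Cons show ?case by (simp add: eval_word_def)
qed (simp add: eval_word_def)

text \<open>The factor contributed by a step. The degree of the variable is recovered from the two ends of
  the edge, so that the labelled edge alone determines the factor.\<close>

definition edge_weight :: "(nat \<times> 'a \<Rightarrow> complex mat) \<Rightarrow> nat \<times> 'a \<times> 'a \<Rightarrow> complex" where
  "edge_weight \<rho> = (\<lambda>(i, s, t). \<rho> (i, s \<otimes> inv t) $$ (idx s, idx t))"

text \<open>In the sum for the matrix product \<open>\<rho> x * M\<close>, row \<open>r\<close> of the first factor leaves only the term at
  the next vertex of the walk.\<close>

lemma eval_word_entry:
  assumes \<rho>: "homogeneous_subst \<rho>" and xs: "set xs \<subseteq> graded_vars G"
    and "r < order G" "c < order G"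
  shows "eval_word (order G) \<rho> (Word xs) $$ (r, c) =
    (if walk_end (f r) xs = f c then \<Prod>x\<in>#mset (walk (f r) xs). edge_weight \<rho> x else 0)"
  using xs assms(3)
proof (induction xs arbitrary: r)
  case Nil
  then show ?case using assms(4) by (simp add: eval_word_def f_eq_iff)
next
  case (Cons x xs)
  obtain i g where x: "x = (i, g)" by force
  have g: "g \<in> carrier G" "(i, g) \<in> graded_vars G" and xs: "set xs \<subseteq> graded_vars G"
    using Cons.prems by (auto simp: graded_vars_def x)
  have \<rho>x: "\<rho> x \<in> carrier_mat (order G) (order G)"
    and zero: "\<And>j. j < order G \<Longrightarrow> f r \<noteq> g \<otimes> f j \<Longrightarrow> \<rho> x $$ (r, j) = 0"
    using \<rho> g crossed_component_iff Cons.prems by (auto simp: homogeneous_subst_def x)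
  define s where "s = inv g \<otimes> f r"
  have s: "s \<in> carrier G" using g Cons.prems by (simp add: s_def)
  have fj: "f j = s" if "j < order G" "f r = g \<otimes> f j" for j
    using that g by (simp add: s_def m_assoc[symmetric])
  let ?M = "eval_word (order G) \<rho> (Word xs)"
  have M: "?M \<in> carrier_mat (order G) (order G)"
    using eval_word_carrier[OF \<rho> xs] .
  have off: "\<rho> x $$ (r, j) = 0" if "j < order G" "j \<noteq> idx s" for j
    using zero[OF that(1)] fj[OF that(1)] idx_f[OF that(1)] that(2) by metis
  have "eval_word (order G) \<rho> (Word (x # xs)) $$ (r, c) = row (\<rho> x) r \<bullet> col ?M c"
    using \<rho>x M Cons.prems assms(4) by (simp add: eval_word_def)
  also have "\<dots> = row (\<rho> x) r $ idx s * col ?M c $ idx s"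
    using \<rho>x M Cons.prems assms(4) idx_less[OF s] off
    by (intro scalar_prod_single) auto
  also have "\<dots> = \<rho> x $$ (r, idx s) * ?M $$ (idx s, c)"
    using \<rho>x M Cons.prems assms(4) idx_less[OF s] by simp
  also have "\<rho> x $$ (r, idx s) = edge_weight \<rho> (i, f r, s)"
    using g Cons.prems
    by (simp add: edge_weight_def x s_def inv_mult_group m_assoc[symmetric] idx_f)
  finally show ?case
    using Cons.IH[OF xs idx_less[OF s]] by (simp add: x f_idx[OF s] flip: s_def)
qed

text \<open>Words with the same graph have the same multiset of steps from \<open>e\<close>, hence by translation from
  every vertex, and therefore equal end vertices and equal products of weights.\<close>

lemma eval_word_cong_graph:
  assumes \<rho>: "homogeneous_subst \<rho>"
    and xs: "xs \<in> multilinear_words G n" and ys: "ys \<in> multilinear_words G n"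
    and eq: "traced_graph n xs = traced_graph n ys"
    and rc: "r < order G" "c < order G"
  shows "eval_word (order G) \<rho> (Word xs) $$ (r, c) = eval_word (order G) \<rho> (Word ys) $$ (r, c)"
proof -
  have snd: "snd ` set xs \<subseteq> carrier G" "snd ` set ys \<subseteq> carrier G"
    using xs ys by (auto simp: multilinear_words_def)
  have "mset (walk \<one> xs) = mset (walk \<one> ys)"
    using mset_walk_eq_traced_graph[OF xs] mset_walk_eq_traced_graph[OF ys] eq by simp
  then have "mset (walk (f r) xs) = mset (walk (f r) ys)"
    using walk_translate[of \<one> "f r" xs] walk_translate[of \<one> "f r" ys] snd rc by simp
  with walk_end_determined[OF this] show ?thesis
    using multilinear_words_graded_vars[OF xs] multilinear_words_graded_vars[OF ys] rc
    by (simp add: eval_word_entry[OF \<rho>])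
qed

text \<open>Substitute for \<open>x\<^sub>i\<^sub>,\<^sub>g\<close> the matrix unit of edge \<open>i\<close> in the graph of \<open>x0\<close> if that edge has degree \<open>g\<close>,
  and \<open>0\<close> otherwise. A step then has weight \<open>1\<close> exactly if it is the edge of \<open>x0\<close> with its label.
  The position is the row of \<open>e\<close> and the column where the walk of \<open>x0\<close> ends.\<close>

lemma separating_subst:
  assumes x0: "x0 \<in> multilinear_words G n"
  obtains \<rho> r c where "homogeneous_subst \<rho>" "r < order G" "c < order G"
    "\<And>xs. xs \<in> multilinear_words G n \<Longrightarrow> eval_word (order G) \<rho> (Word xs) $$ (r, c) =
      (if traced_graph n xs = traced_graph n x0 then 1 else 0)"
proof -
  let ?E = "traced_graph n"
  define \<rho> where "\<rho> = (\<lambda>(i, g). mat (order G) (order G)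
    (\<lambda>(r, c). if f r = g \<otimes> f c \<and> ?E x0 i = (f r, f c) then 1 else 0 :: complex))"
  have \<rho>: "homogeneous_subst \<rho>"
    by (auto simp: homogeneous_subst_def graded_vars_def crossed_component_iff \<rho>_def)
  have v: "walk_end \<one> x0 \<in> carrier G"
    using x0 by (intro walk_end_closed) (auto simp: multilinear_words_def)
  have E_closed: "?E xs l \<in> carrier G \<times> carrier G" if "xs \<in> multilinear_words G n" "l \<in> {1..n}" for xs l
    using labelled_digraphs_edge[OF traced_graph_in_carrier[OF that(1)] that(2)] .
  have weight: "edge_weight \<rho> (l, st) = (if ?E x0 l = st then 1 else 0)"
    if "st \<in> carrier G \<times> carrier G" for l st
    using that by (auto simp: edge_weight_def \<rho>_def idx_less f_idx m_assoc)
  have "eval_word (order G) \<rho> (Word xs) $$ (idx \<one>, idx (walk_end \<one> x0)) =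
      (if ?E xs = ?E x0 then 1 else 0)" if xs: "xs \<in> multilinear_words G n" for xs
  proof -
    have prod: "(\<Prod>x\<in>#mset (walk \<one> xs). edge_weight \<rho> x) =
        (\<Prod>l\<in>{1..n}. if ?E x0 l = ?E xs l then 1 else 0)"
      using E_closed[OF xs]
      by (simp add: mset_walk_eq_traced_graph[OF xs] image_mset.compositionality
          flip: prod_unfold_prod_mset) (auto intro!: prod.cong simp: weight)
    show ?thesis
    proof (cases "?E xs = ?E x0")
      case True
      then have "mset (walk \<one> xs) = mset (walk \<one> x0)"
        using mset_walk_eq_traced_graph[OF xs] mset_walk_eq_traced_graph[OF x0] by simp
      from walk_end_determined[OF this] True show ?thesis
        using multilinear_words_graded_vars[OF xs] v prod
        by (simp add: eval_word_entry[OF \<rho>] idx_less f_idx)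
    next
      case False
      then obtain l where l: "?E xs l \<noteq> ?E x0 l" by blast
      then have "l \<in> {1..n}" by (auto simp: traced_graph_def split: if_splits)
      with l have "(\<Prod>l\<in>{1..n}. if ?E x0 l = ?E xs l then 1 else 0 :: complex) = 0"
        by (intro prod_zero) (auto intro!: bexI[of _ l])
      then show ?thesis
        using multilinear_words_graded_vars[OF xs] v prod False
        by (simp add: eval_word_entry[OF \<rho>] idx_less f_idx)
    qed
  qed
  with \<rho> v show ?thesis by (intro that[of \<rho> "idx \<one>" "idx (walk_end \<one> x0)"]) (auto simp: idx_less)
qed

end


section \<open>Multilinear graded identities\<close>

abbreviation monomial :: "'v list \<Rightarrow> 'v free_alg" where
  "monomial xs \<equiv> Poly_Mapping.single (Word xs) 1"

lemma graded_multilinear_eq_span: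
  "graded_multilinear G n = free_alg.span (monomial ` multilinear_words G n)"
  unfolding graded_multilinear_def multilinear_words_def
  by (intro arg_cong[where f = free_alg.span]) (auto simp: prod_list_var)

lemma subspace_supported: "free_alg.subspace {p :: 'v free_alg. Poly_Mapping.keys p \<subseteq> K}"
proof (rule free_alg.subspaceI)
  fix p q :: "'v free_alg" and c
  show "0 \<in> {p :: 'v free_alg. Poly_Mapping.keys p \<subseteq> K}" by simp
  show "p + q \<in> {p. Poly_Mapping.keys p \<subseteq> K}"
    if "p \<in> {p. Poly_Mapping.keys p \<subseteq> K}" "q \<in> {p. Poly_Mapping.keys p \<subseteq> K}"
    using that Poly_Mapping.keys_add[of p q] by blast
  show "scaleQ c p \<in> {p. Poly_Mapping.keys p \<subseteq> K}" if "p \<in> {p. Poly_Mapping.keys p \<subseteq> K}"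
    using that by (auto simp: in_keys_iff)
qed

lemma graded_multilinear_keys:
  assumes "p \<in> graded_multilinear G n"
  shows "Poly_Mapping.keys p \<subseteq> Word ` multilinear_words G n"
proof -
  have "free_alg.span (monomial ` multilinear_words G n) \<subseteq>
      {p. Poly_Mapping.keys p \<subseteq> Word ` multilinear_words G n}"
    by (intro free_alg.span_minimal subspace_supported) auto
  then show ?thesis using assms by (auto simp: graded_multilinear_eq_span)
qed

lemma lookup_sum_monomials:
  assumes "finite X"
  shows "Poly_Mapping.lookup (\<Sum>ys\<in>X. scaleQ (c ys) (monomial ys)) (Word xs) =
    (if xs \<in> X then c xs else 0)"
  using assms by (simp add: lookup_sum lookup_single when_def if_distrib cong: if_cong)

lemma index_finsum_ring_mat:
  assumes "finite F" "\<And>w. w \<in> F \<Longrightarrow> M w \<in> carrier_mat N N" "r < N" "c < N"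
  shows "(\<Oplus>\<^bsub>ring_mat TYPE('a :: comm_ring_1) N ()\<^esub> w \<in> F. M w) $$ (r, c) = (\<Sum>w\<in>F. M w $$ (r, c))"
proof -
  interpret R: ring "ring_mat TYPE('a) N ()" by (rule ring_mat)
  show ?thesis
    using assms(1,2)
  proof (induction F)
    case empty
    then show ?case using assms(3,4) by (simp add: ring_mat_simps)
  next
    case (insert w F)
    have "(\<Oplus>\<^bsub>ring_mat TYPE('a) N ()\<^esub> w \<in> F. M w) \<in> carrier_mat N N"
      using insert.prems R.finsum_closed[of M F] by (auto simp: ring_mat_simps)
    with insert assms(3,4) show ?case
      by (subst R.finsum_insert) (auto simp: ring_mat_simps)
  qed
qed

context enumerated_group
begin

lemma eval_poly_entry:
  assumes \<rho>: "homogeneous_subst \<rho>" and p: "p \<in> graded_multilinear G n"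
    and rc: "r < order G" "c < order G"
  shows "eval_poly (order G) \<rho> p $$ (r, c) = (\<Sum>xs\<in>multilinear_words G n.
    of_rat (Poly_Mapping.lookup p (Word xs)) * eval_word (order G) \<rho> (Word xs) $$ (r, c))"
proof -
  let ?e = "\<lambda>w. of_rat (Poly_Mapping.lookup p w) * eval_word (order G) \<rho> w $$ (r, c)"
  have w: "eval_word (order G) \<rho> w \<in> carrier_mat (order G) (order G)"
    if "w \<in> Poly_Mapping.keys p" for w
    using that graded_multilinear_keys[OF p] multilinear_words_graded_vars
    by (blast intro: eval_word_carrier[OF \<rho>])
  have "eval_poly (order G) \<rho> p $$ (r, c) = (\<Sum>w\<in>Poly_Mapping.keys p.
      (of_rat (Poly_Mapping.lookup p w) \<cdot>\<^sub>m eval_word (order G) \<rho> w) $$ (r, c))"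
    unfolding eval_poly_def using w rc by (intro index_finsum_ring_mat) auto
  also have "\<dots> = (\<Sum>w\<in>Poly_Mapping.keys p. ?e w)"
    using w rc by (intro sum.cong refl index_smult_mat(1)) force+
  also have "\<dots> = (\<Sum>w\<in>Word ` multilinear_words G n. ?e w)"
    using graded_multilinear_keys[OF p] finite_multilinear_words[OF finite_carrier]
    by (intro sum.mono_neutral_left) (auto simp: in_keys_iff)
  also have "\<dots> = (\<Sum>xs\<in>multilinear_words G n. ?e (Word xs))"
    by (subst sum.reindex) (auto simp: inj_on_def)
  finally show ?thesis .
qed

lemma eval_poly_carrier:
  assumes \<rho>: "homogeneous_subst \<rho>" and p: "p \<in> graded_multilinear G n"
  shows "eval_poly (order G) \<rho> p \<in> carrier_mat (order G) (order G)"
proof -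
  interpret R: ring "ring_mat TYPE(complex) (order G) ()" by (rule ring_mat)
  have "eval_word (order G) \<rho> w \<in> carrier_mat (order G) (order G)"
    if "w \<in> Poly_Mapping.keys p" for w
    using that graded_multilinear_keys[OF p] multilinear_words_graded_vars
    by (blast intro: eval_word_carrier[OF \<rho>])
  then show ?thesis
    unfolding eval_poly_def
    using R.finsum_closed[of _ "Poly_Mapping.keys p"] by (auto simp: ring_mat_simps)
qed

text \<open>This turns the identities into the solutions of a system of linear equations in the coefficients,
  with an index set common to all polynomials in place of the individual supports.\<close>

lemma multilinear_identity_iff:
  "p \<in> graded_multilinear G n \<inter> graded_ids G (order G) (crossed_component G f) \<longleftrightarrow>
    p \<in> graded_multilinear G n \<and>
    (\<forall>\<rho> r c. homogeneous_subst \<rho> \<longrightarrow> r < order G \<longrightarrow> c < order G \<longrightarrow>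
      (\<Sum>xs\<in>multilinear_words G n. of_rat (Poly_Mapping.lookup p (Word xs)) *
        eval_word (order G) \<rho> (Word xs) $$ (r, c)) = 0)"
proof (cases "p \<in> graded_multilinear G n")
  case True
  have "p \<in> free_alg_on (graded_vars G)"
    using graded_multilinear_keys[OF True] multilinear_words_graded_vars
    by (fastforce simp: free_alg_on_def)
  moreover have "eval_poly (order G) \<rho> p = 0\<^sub>m (order G) (order G) \<longleftrightarrow>
      (\<forall>r c. r < order G \<longrightarrow> c < order G \<longrightarrow>
        (\<Sum>xs\<in>multilinear_words G n. of_rat (Poly_Mapping.lookup p (Word xs)) *
          eval_word (order G) \<rho> (Word xs) $$ (r, c)) = 0)" if "homogeneous_subst \<rho>" for \<rho>
    using eval_poly_entry[OF that True] eval_poly_carrier[OF that True] by (auto simp: mat_eq_iff)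
  ultimately show ?thesis
    using True by (auto simp: graded_ids_def homogeneous_subst_def)
qed simp

lemma subspace_multilinear_identities:
  "free_alg.subspace (graded_multilinear G n \<inter> graded_ids G (order G) (crossed_component G f))"
  (is "free_alg.subspace ?N")
proof (rule free_alg.subspaceI)
  have V: "free_alg.subspace (graded_multilinear G n)"
    by (simp add: graded_multilinear_eq_span)
  show "0 \<in> ?N" using free_alg.subspace_0[OF V] unfolding multilinear_identity_iff by simp
  show "p + q \<in> ?N" if "p \<in> ?N" "q \<in> ?N" for p q
    using that free_alg.subspace_add[OF V]
    unfolding multilinear_identity_iff
    by (simp add: lookup_add of_rat_add distrib_right sum.distrib)
  show "scaleQ a p \<in> ?N" if "p \<in> ?N" for a p
    using that free_alg.subspace_scale[OF V]
    unfolding multilinear_identity_iff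
    by (simp add: of_rat_mult mult.assoc flip: sum_distrib_left)
qed

lemma codim_eq_card_traced_graphs:
  "graded_codim G (order G) (crossed_component G f) n =
    card (traced_graph n ` multilinear_words G n)"
proof -
  let ?N = "graded_multilinear G n \<inter> graded_ids G (order G) (crossed_component G f)"
  let ?W = "multilinear_words G n"
  have fin: "finite ?W" by (rule finite_multilinear_words[OF finite_carrier])
  have "quotient_dim scaleQ (free_alg.span (monomial ` ?W)) ?N = card (traced_graph n ` ?W)"
  proof (rule free_alg.quotient_dim_span_classes[OF fin subspace_multilinear_identities])
    fix xs ys assume xy: "xs \<in> ?W" "ys \<in> ?W" "traced_graph n xs = traced_graph n ys"
    have "(\<Sum>zs\<in>?W. of_rat (Poly_Mapping.lookup (monomial xs - monomial ys) (Word zs)) *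
        eval_word (order G) \<rho> (Word zs) $$ (r, c)) = 0"
      if "homogeneous_subst \<rho>" "r < order G" "c < order G" for \<rho> r c
    proof -
      have "(\<Sum>zs\<in>?W. of_rat (Poly_Mapping.lookup (monomial xs - monomial ys) (Word zs)) *
          eval_word (order G) \<rho> (Word zs) $$ (r, c)) =
        (\<Sum>zs\<in>?W. (if xs = zs then eval_word (order G) \<rho> (Word zs) $$ (r, c) else 0) -
          (if ys = zs then eval_word (order G) \<rho> (Word zs) $$ (r, c) else 0))"
        by (intro sum.cong) (auto simp: lookup_minus lookup_single when_def of_rat_diff)
      also have "\<dots> = 0"
        using xy fin eval_word_cong_graph[OF that(1) xy that(2,3)] by (simp add: sum_subtractf)
      finally show ?thesis .
    qed
    moreover have "monomial xs - monomial ys \<in> graded_multilinear G n"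
      unfolding graded_multilinear_eq_span
      using xy by (intro free_alg.span_diff free_alg.span_base) auto
    ultimately show "monomial xs - monomial ys \<in> ?N"
      unfolding multilinear_identity_iff by blast
  next
    fix a x0 assume N: "(\<Sum>ys\<in>?W. scaleQ (a ys) (monomial ys)) \<in> ?N" and x0: "x0 \<in> ?W"
    obtain \<rho> r c where \<rho>: "homogeneous_subst \<rho>" "r < order G" "c < order G"
      and sep: "\<And>xs. xs \<in> ?W \<Longrightarrow> eval_word (order G) \<rho> (Word xs) $$ (r, c) =
        (if traced_graph n xs = traced_graph n x0 then 1 else 0)"
      using separating_subst[OF x0] by metis
    have "0 = (\<Sum>xs\<in>?W. of_rat (a xs) * eval_word (order G) \<rho> (Word xs) $$ (r, c))"
      using N \<rho> unfolding multilinear_identity_iff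
      by (simp add: lookup_sum_monomials[OF fin])
    also have "\<dots> = (\<Sum>xs\<in>?W. if traced_graph n xs = traced_graph n x0 then of_rat (a xs) else 0)"
      by (intro sum.cong) (auto simp: sep)
    also have "\<dots> = of_rat (\<Sum>xs | xs \<in> ?W \<and> traced_graph n xs = traced_graph n x0. a xs)"
      by (simp add: of_rat_sum fin sum.inter_filter if_distrib[of of_rat] cong: if_cong)
    finally show "(\<Sum>xs | xs \<in> ?W \<and> traced_graph n xs = traced_graph n x0. a xs) = 0"
      by simp
  qed
  then show ?thesis by (simp add: graded_codim_def graded_multilinear_eq_span)
qed

theorem codim_eq_eulerian_count:
  assumes "n \<ge> 1"
  shows "graded_codim G (order G) (crossed_component G f) n = eulerian_count (carrier G) \<one> n"
  by (simp only: codim_eq_card_traced_graphs eulerian_count_def eulerian_iff_traced_graph[OF assms])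

end


section \<open>Independence of the group\<close>

definition relabel :: "nat \<Rightarrow> ('a \<Rightarrow> 'b) \<Rightarrow> (nat \<Rightarrow> 'a \<times> 'a) \<Rightarrow> nat \<Rightarrow> 'b \<times> 'b" where
  "relabel n \<phi> E = (\<lambda>l\<in>{1..n}. map_prod \<phi> \<phi> (E l))"

lemma eulerian_path_relabel:
  assumes "eulerian_path n E a b p" "n \<ge> 1"
  shows "eulerian_path n (relabel n \<phi> E) (\<phi> a) (\<phi> b) p"
proof -
  have p: "distinct p" "set p = {1..n}" and ne: "p \<noteq> []"
    using assms by (auto simp: eulerian_path_def)
  have "p ! l \<in> {1..n}" if "l < length p" for l using nth_mem[OF that] p by simp
  moreover have "hd p \<in> {1..n}" "last p \<in> {1..n}" using hd_in_set[OF ne] last_in_set[OF ne] p by auto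
  ultimately show ?thesis using assms by (simp add: eulerian_path_def relabel_def)
qed

text \<open>An injection of vertex sets maps graphs injectively to graphs and keeps each Eulerian path, as the
  enumeration of the labels does not change.\<close>

lemma eulerian_count_le:
  assumes \<phi>: "inj_on \<phi> V" "\<phi> ` V \<subseteq> V'" and V': "finite V'" and n: "n \<ge> 1"
  shows "eulerian_count V a n \<le> eulerian_count V' (\<phi> a) n"
  unfolding eulerian_count_def
proof (rule card_inj_on_le)
  show "relabel n \<phi> ` {E \<in> labelled_digraphs V n. \<exists>b\<in>V. \<exists>p. eulerian_path n E a b p}
      \<subseteq> {E \<in> labelled_digraphs V' n. \<exists>b\<in>V'. \<exists>p. eulerian_path n E (\<phi> a) b p}" (is "?L \<subseteq> ?R")
  proof
    fix F assume "F \<in> ?L"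
    then obtain E b p where F: "F = relabel n \<phi> E" and E: "E \<in> labelled_digraphs V n"
      and b: "b \<in> V" "eulerian_path n E a b p" by auto
    have "map_prod \<phi> \<phi> (E l) \<in> V' \<times> V'" if "l \<in> {1..n}" for l
    proof -
      from labelled_digraphs_edge[OF E that] show ?thesis
        using \<phi>(2) by (auto simp: image_subset_iff)
    qed
    then have "F \<in> labelled_digraphs V' n"
      by (simp add: F labelled_digraphs_def relabel_def)
    then show "F \<in> ?R" using eulerian_path_relabel[OF b(2) n] b(1) \<phi> F by blast
  qed
  show "inj_on (relabel n \<phi>) {E \<in> labelled_digraphs V n. \<exists>b\<in>V. \<exists>p. eulerian_path n E a b p}"
  proof (rule inj_onI)
    fix E F assume EF: "E \<in> {E \<in> labelled_digraphs V n. \<exists>b\<in>V. \<exists>p. eulerian_path n E a b p}"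
      "F \<in> {E \<in> labelled_digraphs V n. \<exists>b\<in>V. \<exists>p. eulerian_path n E a b p}"
      and eq: "relabel n \<phi> E = relabel n \<phi> F"
    show "E = F"
    proof (rule PiE_ext)
      show EV: "E \<in> {1..n} \<rightarrow>\<^sub>E V \<times> V" and FV: "F \<in> {1..n} \<rightarrow>\<^sub>E V \<times> V"
        using EF by (auto simp: labelled_digraphs_def)
      fix l assume l: "l \<in> {1..n}"
      then have "map_prod \<phi> \<phi> (E l) = map_prod \<phi> \<phi> (F l)"
        using fun_cong[OF eq, of l] by (simp add: relabel_def)
      with PiE_mem[OF EV l] PiE_mem[OF FV l] show "E l = F l"
        using map_prod_inj_on[OF \<phi>(1) \<phi>(1)] by (auto dest: inj_onD)
    qed
  qed
  show "finite {E \<in> labelled_digraphs V' n. \<exists>b\<in>V'. \<exists>p. eulerian_path n E (\<phi> a) b p}"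
    using V' by (simp add: labelled_digraphs_def finite_PiE)
qed

lemma bij_betw_pointed:
  assumes "finite V" "finite V'" "card V = card V'" "a \<in> V" "a' \<in> V'"
  obtains \<phi> where "bij_betw \<phi> V V'" "\<phi> a = a'"
proof -
  have "card (V - {a}) = card (V' - {a'})" using assms by simp
  then obtain \<psi> where \<psi>: "bij_betw \<psi> (V - {a}) (V' - {a'})"
    using assms finite_same_card_bij[of "V - {a}" "V' - {a'}"] by auto
  have "bij_betw (\<psi>(a := a')) (V - {a}) (V' - {a'})"
    using \<psi> by (subst bij_betw_cong[of _ _ \<psi>]) auto
  from notIn_Un_bij_betw[OF _ _ this, of a] have "bij_betw (\<psi>(a := a')) V V'"
    using assms by (simp add: insert_absorb)
  then show ?thesis by (rule that) simp
qed

lemma eulerian_count_eq: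
  assumes "finite V" "finite V'" "card V = card V'" "a \<in> V" "a' \<in> V'" "n \<ge> 1"
  shows "eulerian_count V a n = eulerian_count V' a' n"
proof (rule antisym)
  show "eulerian_count V a n \<le> eulerian_count V' a' n"
    using bij_betw_pointed[of V V' a a'] eulerian_count_le[of _ V V' n a] assms
    by (metis bij_betw_imp_inj_on bij_betw_imp_surj_on order_refl)
  show "eulerian_count V' a' n \<le> eulerian_count V a n"
    using bij_betw_pointed[of V' V a' a] eulerian_count_le[of _ V' V n a'] assms
    by (metis bij_betw_imp_inj_on bij_betw_imp_surj_on order_refl)
qed

theorem theorem12:
  fixes G :: "('a, 'm) monoid_scheme" and H :: "('b, 'n) monoid_scheme"
    and f :: "nat \<Rightarrow> 'a" and f' :: "nat \<Rightarrow> 'b" and k n :: nat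
  assumes "group G" and "order G = k" and "k \<ge> 2" and "n \<ge> 1"
    and "bij_betw f {..<k} (carrier G)"
  shows "graded_codim G k (crossed_component G f) n = eulerian_count (carrier G) \<one>\<^bsub>G\<^esub> n \<and>
    (group H \<and> order H = k \<and> bij_betw f' {..<k} (carrier H) \<longrightarrow>
      graded_codim H k (crossed_component H f') n = graded_codim G k (crossed_component G f) n)"
proof (intro conjI impI)
  interpret G: enumerated_group G f
    using assms by (simp add: enumerated_group_def enumerated_group_axioms_def)
  show *: "graded_codim G k (crossed_component G f) n = eulerian_count (carrier G) \<one>\<^bsub>G\<^esub> n"
    using G.codim_eq_eulerian_count assms by simp
  assume H: "group H \<and> order H = k \<and> bij_betw f' {..<k} (carrier H)"
  interpret H: enumerated_group H f'
    using H by (simp add: enumerated_group_def enumerated_group_axioms_def)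
  have "graded_codim H k (crossed_component H f') n = eulerian_count (carrier H) \<one>\<^bsub>H\<^esub> n"
    using H.codim_eq_eulerian_count assms H by simp
  also have "\<dots> = eulerian_count (carrier G) \<one>\<^bsub>G\<^esub> n"
    using assms H G.finite_carrier H.finite_carrier
    by (intro eulerian_count_eq) (auto simp: order_def)
  finally show "graded_codim H k (crossed_component H f') n =
      graded_codim G k (crossed_component G f) n"
    using * by simp
qed

end
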